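(* Let $P$ be a finite self-dual poset with $n=\#P$, and fix an order-reversing bijection $\kappa:P\to P$. Then the statistic $\hat\chi:\mathcal I(P)\to\mathbb N$, $\hat\chi(I)=\#I$, is $(n/2)$-mesic on dihedral group orbits; that is, for every dihedral group orbit $\mathcal D\subseteq\mathcal I(P)$, $$\frac{1}{\#\mathcal D}\sum_{I\in\mathcal D}\#I=\frac n2 .$$
   Context: $\mathcal I(P)$ is the set of (lower order) ideals of $P$. Rowmotion on ideals is the bijection $\hat\rho:\mathcal I(P)\to\mathcal I(P)$ sending $I$ to the ideal generated by the minimal elements of $P\setminus I$. A poset is self-dual if it has an order-reversing bijection $\kappa:P\to P$ (an anti-automorphism). The ideal complement of $I\in\mathcal I(P)$ with respect to $\kappa$ is $\overline I=\kappa(P\setminus I)\in\mathcal I(P)$. The dihedral group orbits are the orbits on $\mathcal I(P)$ of the group of permutations generated by $\hat\rho$ and $I\mapsto\overline I$. *)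

theory Defs
  imports Complex_Main "HOL-Algebra.Group_Action" "HOL-Algebra.Generated_Groups"
begin

text \<open>
  A poset is a carrier set \<open>P\<close> with a relation \<open>r\<close> such that \<open>partial_order_on P r\<close>;
  \<open>(x, y) \<in> r\<close> is read as \<open>x \<le> y\<close>.
\<close>

definition ideals :: "'a set \<Rightarrow> 'a rel \<Rightarrow> 'a set set" where
  "ideals P r = {I. I \<subseteq> P \<and> (\<forall>x\<in>I. \<forall>y\<in>P. (y, x) \<in> r \<longrightarrow> y \<in> I)}"

definition ideal_generated :: "'a set \<Rightarrow> 'a rel \<Rightarrow> 'a set \<Rightarrow> 'a set" where
  "ideal_generated P r S = {y \<in> P. \<exists>x\<in>S. (y, x) \<in> r}"

definition minimal_elements :: "'a rel \<Rightarrow> 'a set \<Rightarrow> 'a set" where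
  "minimal_elements r S = {x \<in> S. \<forall>y\<in>S. (y, x) \<in> r \<longrightarrow> y = x}"

definition rowmotion :: "'a set \<Rightarrow> 'a rel \<Rightarrow> 'a set \<Rightarrow> 'a set" where
  "rowmotion P r I = ideal_generated P r (minimal_elements r (P - I))"

definition anti_automorphism :: "'a set \<Rightarrow> 'a rel \<Rightarrow> ('a \<Rightarrow> 'a) \<Rightarrow> bool" where
  "anti_automorphism P r \<kappa> \<longleftrightarrow>
     bij_betw \<kappa> P P \<and> (\<forall>x\<in>P. \<forall>y\<in>P. (x, y) \<in> r \<longleftrightarrow> (\<kappa> y, \<kappa> x) \<in> r)"

definition ideal_complement :: "'a set \<Rightarrow> ('a \<Rightarrow> 'a) \<Rightarrow> 'a set \<Rightarrow> 'a set" where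
  "ideal_complement P \<kappa> I = \<kappa> ` (P - I)"

text \<open>
  Elements of \<^term>\<open>BijGroup S\<close> are extensional functions, so both generators are
  restricted to the set of ideals.  Since \<^const>\<open>subgroup_generated\<close> ignores generators
  outside the carrier, the lemmas \<open>rowmotion_Bij\<close> and \<open>ideal_complement_Bij\<close> below
  matter: they show that nothing is discarded.  The map \<open>\<kappa>\<close> need not be an
  involution, so this group need not literally be dihedral.
\<close>

definition dihedral_group ::
    "'a set \<Rightarrow> 'a rel \<Rightarrow> ('a \<Rightarrow> 'a) \<Rightarrow> ('a set \<Rightarrow> 'a set) monoid" where
  "dihedral_group P r \<kappa> =
     subgroup_generated (BijGroup (ideals P r))
       {restrict (rowmotion P r) (ideals P r),
        restrict (ideal_complement P \<kappa>) (ideals P r)}"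

definition dihedral_orbits :: "'a set \<Rightarrow> 'a rel \<Rightarrow> ('a \<Rightarrow> 'a) \<Rightarrow> 'a set set set" where
  "dihedral_orbits P r \<kappa> = orbits (dihedral_group P r \<kappa>) (ideals P r) (\<lambda>g. g)"

definition mesic_on :: "real \<Rightarrow> ('s \<Rightarrow> nat) \<Rightarrow> 's set set \<Rightarrow> bool" where
  "mesic_on c f \<O> \<longleftrightarrow> (\<forall>D\<in>\<O>. 1 / real (card D) * (\<Sum>x\<in>D. real (f x)) = c)"

lemma anti_automorphism_finiteI:
  assumes "finite P" "partial_order_on P r" "bij_betw \<kappa> P P"
    and rev: "\<And>x y. x \<in> P \<Longrightarrow> y \<in> P \<Longrightarrow> (x, y) \<in> r \<Longrightarrow> (\<kappa> y, \<kappa> x) \<in> r"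
  shows "anti_automorphism P r \<kappa>"
proof -
  have rP: "r \<subseteq> P \<times> P" using assms(2) by (rule partial_order_onD)
  have inj: "inj_on \<kappa> P" using assms(3) by (rule bij_betw_imp_inj_on)
  let ?f = "\<lambda>(x, y). (\<kappa> y, \<kappa> x)"
  have "inj_on ?f r"
  proof (rule inj_onI)
    fix p q assume pq: "p \<in> r" "q \<in> r" "?f p = ?f q"
    obtain a b c d where [simp]: "p = (a, b)" "q = (c, d)" by (cases p, cases q) blast
    have "a \<in> P" "b \<in> P" "c \<in> P" "d \<in> P" using pq rP by auto
    then show "p = q" using pq inj by (simp add: inj_on_eq_iff)
  qed
  moreover have "?f ` r \<subseteq> r" using rP rev by auto
  moreover have "finite r" using rP assms(1) by (meson finite_SigmaI finite_subset)
  ultimately have surj: "?f ` r = r" by (simp add: endo_inj_surj)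
  have "(x, y) \<in> r" if "x \<in> P" "y \<in> P" "(\<kappa> y, \<kappa> x) \<in> r" for x y
  proof -
    have "(\<kappa> y, \<kappa> x) \<in> ?f ` r" using surj that(3) by simp
    then obtain a b where ab: "(a, b) \<in> r" "\<kappa> y = \<kappa> b" "\<kappa> x = \<kappa> a" by auto
    moreover have "a \<in> P" "b \<in> P" using ab(1) rP by auto
    ultimately show ?thesis using that(1,2) inj by (simp add: inj_on_eq_iff)
  qed
  then show ?thesis using assms(3) rev by (auto simp: anti_automorphism_def)
qed

lemma ideal_complement_Bij:
  assumes "finite P" "partial_order_on P r" "anti_automorphism P r \<kappa>"
  shows "restrict (ideal_complement P \<kappa>) (ideals P r) \<in> Bij (ideals P r)"
proof -
  have bij: "bij_betw \<kappa> P P"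
    and rev: "\<And>x y. x \<in> P \<Longrightarrow> y \<in> P \<Longrightarrow> (x, y) \<in> r \<longleftrightarrow> (\<kappa> y, \<kappa> x) \<in> r"
    using assms(3) by (auto simp: anti_automorphism_def)
  have inj: "inj_on \<kappa> P" and im: "\<kappa> ` P = P" using bij by (auto simp: bij_betw_def)
  let ?S = "ideals P r"
  have fin: "finite ?S"
    by (rule finite_subset[of _ "Pow P"]) (use assms(1) in \<open>auto simp: ideals_def\<close>)
  have maps: "ideal_complement P \<kappa> ` ?S \<subseteq> ?S"
  proof clarify
    fix I assume I: "I \<in> ?S"
    show "ideal_complement P \<kappa> I \<in> ?S"
      unfolding ideals_def ideal_complement_def
    proof (intro CollectI conjI ballI impI)
      show "\<kappa> ` (P - I) \<subseteq> P" using im by blast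
      fix x y assume "x \<in> \<kappa> ` (P - I)" "y \<in> P" "(y, x) \<in> r"
      then obtain a b where ab: "a \<in> P" "a \<notin> I" "x = \<kappa> a" "b \<in> P" "y = \<kappa> b"
        using im by blast
      then have "(a, b) \<in> r" using rev \<open>(y, x) \<in> r\<close> by blast
      then have "b \<notin> I" using I ab by (auto simp: ideals_def)
      then show "y \<in> \<kappa> ` (P - I)" using ab by blast
    qed
  qed
  have "inj_on (ideal_complement P \<kappa>) ?S"
  proof (rule inj_onI)
    fix I J assume IJ: "I \<in> ?S" "J \<in> ?S" "ideal_complement P \<kappa> I = ideal_complement P \<kappa> J"
    then have "P - I = P - J"
      using inj_on_image_eq_iff[OF inj, of "P - I" "P - J"] by (auto simp: ideal_complement_def)
    then show "I = J" using IJ by (auto simp: ideals_def)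
  qed
  with maps fin have "bij_betw (ideal_complement P \<kappa>) ?S ?S"
    by (simp add: bij_betw_def endo_inj_surj)
  then show ?thesis by (simp add: Bij_def)
qed

lemma rowmotion_Bij:
  assumes "finite P" "partial_order_on P r"
  shows "restrict (rowmotion P r) (ideals P r) \<in> Bij (ideals P r)"
proof -
  have rP: "r \<subseteq> P \<times> P" and tr: "trans r" and an: "antisym r" and rf: "refl_on P r"
    using assms(2) by (auto dest: partial_order_onD)
  let ?S = "ideals P r"
  have fin: "finite ?S"
    by (rule finite_subset[of _ "Pow P"]) (use assms(1) in \<open>auto simp: ideals_def\<close>)
  have maps: "rowmotion P r ` ?S \<subseteq> ?S"
    unfolding ideals_def rowmotion_def ideal_generated_def using transD[OF tr] by blast
  have below: "\<exists>m\<in>minimal_elements r Q. (m, x) \<in> r" if "Q \<subseteq> P" "x \<in> Q" for Q x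
  proof -
    have "finite r" using rP assms(1) by (meson finite_SigmaI finite_subset)
    then have wf: "wf (r - Id)" using assms(2) by (rule partial_order_on_well_order_on)
    let ?B = "{y \<in> Q. (y, x) \<in> r}"
    have "x \<in> ?B" using that rf by (auto simp: refl_on_def)
    then obtain m where m: "m \<in> ?B" "\<And>y. (y, m) \<in> r - Id \<Longrightarrow> y \<notin> ?B"
      using wfE_min[OF wf, of x ?B] by blast
    have "y = m" if "y \<in> Q" "(y, m) \<in> r" for y
      using m(1) m(2)[of y] that transD[OF tr that(2)] by blast
    with m(1) have "m \<in> minimal_elements r Q" by (simp add: minimal_elements_def)
    with m show ?thesis by blast
  qed
  have recover: "P - I = {x \<in> P. \<exists>m\<in>minimal_elements (r\<inverse>) (rowmotion P r I). (m, x) \<in> r}"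
    if I: "I \<in> ?S" for I
  proof -
    have "minimal_elements (r\<inverse>) (rowmotion P r I) = minimal_elements r (P - I)"
    proof (intro equalityI subsetI)
      fix x assume x: "x \<in> minimal_elements (r\<inverse>) (rowmotion P r I)"
      then obtain m where m: "m \<in> minimal_elements r (P - I)" "(x, m) \<in> r"
        by (auto simp: minimal_elements_def rowmotion_def ideal_generated_def)
      moreover have "m \<in> rowmotion P r I"
        using m rf by (auto simp: minimal_elements_def rowmotion_def ideal_generated_def refl_on_def)
      ultimately have "m = x" using x by (auto simp: minimal_elements_def)
      then show "x \<in> minimal_elements r (P - I)" using m by simp
    next
      fix x assume x: "x \<in> minimal_elements r (P - I)"
      have 1: "x \<in> rowmotion P r I"
        using x rf by (auto simp: minimal_elements_def rowmotion_def ideal_generated_def refl_on_def)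
      have "y = x" if y: "y \<in> rowmotion P r I" "(x, y) \<in> r" for y
      proof -
        from y obtain m where m: "m \<in> minimal_elements r (P - I)" "(y, m) \<in> r"
          by (auto simp: rowmotion_def ideal_generated_def)
        then have "(x, m) \<in> r" using y transD[OF tr] by blast
        then have "x = m" using m x by (auto simp: minimal_elements_def)
        then show ?thesis using m y antisymD[OF an] by blast
      qed
      with 1 show "x \<in> minimal_elements (r\<inverse>) (rowmotion P r I)"
        by (auto simp: minimal_elements_def)
    qed
    moreover have "x \<notin> I" if "m \<in> P - I" "(m, x) \<in> r" for m x
      using I that by (auto simp: ideals_def)
    ultimately show ?thesis
      using below[of "P - I"] unfolding minimal_elements_def by blast
  qed
  have "inj_on (rowmotion P r) ?S"
  proof (rule inj_onI)
    fix I J assume IJ: "I \<in> ?S" "J \<in> ?S" "rowmotion P r I = rowmotion P r J"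
    then have "P - I = P - J" by (simp only: recover)
    then show "I = J" using IJ by (auto simp: ideals_def)
  qed
  with maps fin have "bij_betw (rowmotion P r) ?S ?S"
    by (simp add: bij_betw_def endo_inj_surj)
  then show ?thesis by (simp add: Bij_def)
qed

end

theory Submission
  imports Defs
begin

text \<open>
  Every orbit \<open>D\<close> is mapped bijectively to itself by \<open>I \<mapsto> \<kappa>(P - I)\<close>, which replaces
  \<open>#I\<close> by \<open>n - #I\<close>; hence \<open>\<Sum>\<^sub>D #I = \<Sum>\<^sub>D (n - #I)\<close>.
\<close>

text \<open>Left multiplication by \<open>c\<close> permutes the group elements, so \<open>c\<close>
  sends \<open>g x\<close> to the point of the orbit given by the product of \<open>c\<close> and
  \<open>g\<close>. Finiteness of \<open>S\<close> turns the resulting injective self-map of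
  \<open>D\<close> into a bijection.\<close>

lemma bij_betw_orbit_of_generator:
  assumes D: "D \<in> orbits (subgroup_generated (BijGroup S) A) S (\<lambda>g. g)"
    and c: "c \<in> A" "c \<in> Bij S"
    and "finite S"
  shows "D \<subseteq> S" "D \<noteq> {}" "bij_betw c D D"
proof -
  let ?G = "subgroup_generated (BijGroup S) A"
  interpret B: group "BijGroup S" by (rule group_BijGroup)
  interpret G: group ?G by (rule B.group_subgroup_generated)
  have G_sub: "carrier ?G \<subseteq> Bij S"
    using B.carrier_subgroup_generated_subset[of A] by (simp add: BijGroup_def)
  \<comment> \<open>The generators actually used are those in the carrier of
    \<open>BijGroup S\<close>, so \<open>c \<in> A\<close> alone would not suffice.\<close>
  have c_G: "c \<in> carrier ?G"
    unfolding carrier_subgroup_generated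
    using c by (auto simp: BijGroup_def intro: generate.incl)
  obtain x where x: "x \<in> S" and D_eq: "D = {g x | g. g \<in> carrier ?G}"
    using D by (auto simp: orbits_def orbit_def)
  show sub: "D \<subseteq> S"
    using x G_sub by (auto simp: D_eq dest!: Bij_imp_funcset)
  show "D \<noteq> {}" using c_G by (auto simp: D_eq)
  have "c ` D \<subseteq> D"
  proof clarify
    fix y assume "y \<in> D"
    then obtain g where g: "g \<in> carrier ?G" "y = g x" by (auto simp: D_eq)
    have "c \<otimes>\<^bsub>?G\<^esub> g \<in> carrier ?G" using c_G g(1) by (rule G.m_closed)
    \<comment> \<open>The product in \<open>BijGroup S\<close> is composition restricted to
      \<open>S\<close>; it can be evaluated here because \<open>c\<close> and \<open>g\<close> lie
      in \<open>Bij S\<close> and \<open>x\<close> in \<open>S\<close>.\<close>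
    moreover have "(c \<otimes>\<^bsub>?G\<^esub> g) x = c y"
      using g G_sub c(2) x by (auto simp: BijGroup_def compose_def)
    ultimately show "c y \<in> D" unfolding D_eq by (metis (mono_tags, lifting) mem_Collect_eq)
  qed
  moreover have "inj_on c D"
    using c(2) sub by (auto simp: Bij_def bij_betw_def intro: inj_on_subset)
  moreover have "finite D" using sub \<open>finite S\<close> by (rule finite_subset)
  ultimately show "bij_betw c D D" by (simp add: bij_betw_def endo_inj_surj)
qed

text \<open>Injectivity of \<open>\<kappa>\<close> preserves the size of \<open>P - I\<close>.
  Working in the reals avoids truncated subtraction when summing over an orbit.\<close>

lemma card_ideal_complement:
  assumes "finite P" "inj_on \<kappa> P" "I \<subseteq> P"
  shows "real (card (ideal_complement P \<kappa> I)) = real (card P) - real (card I)"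
proof -
  have "card (ideal_complement P \<kappa> I) = card (P - I)"
    unfolding ideal_complement_def using assms(2) by (intro card_image) (blast intro: inj_on_subset)
  then show ?thesis
    using assms(1,3) by (simp add: card_Diff_subset finite_subset card_mono of_nat_diff)
qed

theorem theorem3p4:
  fixes P :: "'a set" and r :: "'a rel" and \<kappa> :: "'a \<Rightarrow> 'a" and n :: nat
  assumes "finite P"
    and "partial_order_on P r"
    and "n = card P"
    and "anti_automorphism P r \<kappa>"
  shows "mesic_on (real n / 2) (\<lambda>I. card I) (dihedral_orbits P r \<kappa>)"
  unfolding mesic_on_def
proof
  fix D assume D: "D \<in> dihedral_orbits P r \<kappa>"
  let ?S = "ideals P r"
  let ?c = "restrict (ideal_complement P \<kappa>) ?S"
  have finS: "finite ?S"
    by (rule finite_subset[of _ "Pow P"]) (use assms(1) in \<open>auto simp: ideals_def\<close>)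
  have inj: "inj_on \<kappa> P"
    using assms(4) by (auto simp: anti_automorphism_def bij_betw_def)
  have "?c \<in> Bij ?S" using assms(1,2,4) by (rule ideal_complement_Bij)
  \<comment> \<open>The open premise, that \<open>?c\<close> is one of the two generators, is
    discharged by \<open>simplified\<close>.\<close>
  note orb = bij_betw_orbit_of_generator[OF
      D[unfolded dihedral_orbits_def dihedral_group_def] _ this finS, simplified]
  have "(\<Sum>I\<in>D. real (card I)) = (\<Sum>I\<in>D. real (card (?c I)))"
    using sum.reindex_bij_betw[OF orb(3), of "\<lambda>I. real (card I)"] by simp
  also have "\<dots> = (\<Sum>I\<in>D. real n - real (card I))"
  proof (rule sum.cong[OF refl])
    fix I assume "I \<in> D"
    \<comment> \<open>Only on \<open>?S\<close> does the restricted map \<open>?c\<close> agree with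
      \<open>ideal_complement P \<kappa>\<close>.\<close>
    then have "I \<in> ?S" using orb(1) by blast
    then show "real (card (?c I)) = real n - real (card I)"
      using card_ideal_complement[OF assms(1) inj, of I] assms(3) by (simp add: ideals_def)
  qed
  finally have "2 * (\<Sum>I\<in>D. real (card I)) = real (card D) * real n"
    by (simp add: sum_subtractf)
  \<comment> \<open>Since \<open>1 / 0 = 0\<close> in HOL, the average has its intended meaning only
    for a finite nonempty orbit.\<close>
  moreover have "card D > 0"
    using orb(1,2) finS by (simp add: card_gt_0_iff finite_subset)
  ultimately show "1 / real (card D) * (\<Sum>I\<in>D. real (card I)) = real n / 2"
    by (simp add: field_simps)
qed

end
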